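(* Let $\mathcal{S}$ be a partially ordered semiring satisfying the axioms A1, A2, A3 listed in the context (for instance the max-times algebra or the usual nonnegative algebra on $\mathbb{R}_+$). Let $A\in\mathcal{S}^{n\times n}$ and $b\in\mathcal{S}^n$ be such that the equation $x=Ax+b$ has a solution $x\in\mathcal{S}^n$. Write $A^{\ast}b:=\sup_{k\ge 1}\,(b+Ab+A^2b+\dots+A^{k-1}b)$. Then: (a) The set of all solutions $x\in\mathcal{S}^n$ of $x=Ax+b$ is $\{v+A^{\ast}b : v\in\mathcal{S}^n,\ Av=v\}$. (b) If for every $x\in\mathcal{S}^n$ such that $Ax\le x$ we have $\inf_{k} A^kx=0$, then $A^{\ast}b$ is the unique solution of $x=Ax+b$.
   Context: A semiring $\mathcal{S}$ is a set with operations $+$ and $\cdot$ such that addition is commutative; addition and multiplication are associative; multiplication distributes over addition ($a(b+c)=ab+ac$ and $(b+c)a=ba+ca$); and there are elements $\mathbf{0}$ and $\mathbf{1}$ with $a+\mathbf{0}=a$, $a\mathbf{1}=\mathbf{1}a=a$, $a\mathbf{0}=\mathbf{0}a=\mathbf{0}$ for all $a\in\mathcal{S}$. Multiplication need not be commutative. The semiring $\mathcal{S}$ is endowed with a partial order $\le$ satisfying: A1. Any (nonempty) countable ascending chain (linearly ordered subset) in $\mathcal{S}$ that is bounded from above has a supremum in $\mathcal{S}$, and any (nonempty) countable descending chain has an infimum in $\mathcal{S}$. A2. Addition is nondecreasing: $a+b\ge a$ and $a+b\ge b$ for all $a,b\in\mathcal{S}$. A3. Both operations distribute over any supremum or infimum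 of any such chain: for any countable ascending chain $\{b_\mu\}\subseteq\mathcal{S}$ bounded from above, any countable descending chain $\{d_\mu\}\subseteq\mathcal{S}$ and all $a,a',c,c'\in\mathcal{S}$, $a+\sup_\mu b_\mu=\sup_\mu(a+b_\mu)$, $a'\cdot\sup_\mu b_\mu=\sup_\mu(a'\cdot b_\mu)$, $c+\inf_\mu d_\mu=\inf_\mu(c+d_\mu)$, $c'\cdot\inf_\mu d_\mu=\inf_\mu(c'\cdot d_\mu)$. Matrix and vector operations over $\mathcal{S}$ are defined as usual: $(A+B)_{ij}=a_{ij}+b_{ij}$, $(AB)_{ik}=\sum_j a_{ij}b_{jk}$, and $A^0=I$ is the identity matrix (diagonal entries $\mathbf{1}$, off-diagonal entries $\mathbf{0}$). The partial order is extended to $\mathcal{S}^n$ componentwise, and suprema and infima of vectors are with respect to this order. The vector with all components $\mathbf{0}$ is denoted by $0$. The symbol $A^{\ast}b$ denotes the supremum given in the claim (part of the assertion is that it exists in $\mathcal{S}^n$ when $x=Ax+b$ is solvable); it need not be the product of $b$ with a matrix over $\mathcal{S}$. Two leading examples: the max-times algebra, i.e. the nonnegative reals $\mathbb{R}_+$ with the usual multiplication and addition $a+b:=\max(a,b)$; and the usual nonnegative algebra, i.e. $\mathbb{R}_+$ with the usual addition and multiplication; both with the usual order. *)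

theory Defs
  imports
    "Jordan_Normal_Form.Matrix"
    "HOL-Library.Lub_Glb"
    "HOL-Library.Countable_Set"
begin

text \<open>
  The sort \<open>{semiring_0, monoid_mult, order}\<close> is used instead of \<open>{semiring_1, order}\<close> because
  \<open>0 \<noteq> 1\<close> is not required. The order is not assumed compatible with the
  operations beyond the axioms below. In a statement of the form
  \<open>isLub UNIV (f ` C) (f s)\<close> the supremum of the image is asserted to exist and to be \<open>f s\<close>.
\<close>

locale partially_ordered_semiring =
  fixes S :: "'a :: {semiring_0, monoid_mult, order} itself"
  assumes A1_sup: "\<And>C :: 'a set. \<lbrakk>C \<noteq> {}; countable C; Complete_Partial_Order.chain (\<le>) C; bdd_above C\<rbrakk>
      \<Longrightarrow> \<exists>s. isLub UNIV C s"
    and A1_inf: "\<And>C :: 'a set. \<lbrakk>C \<noteq> {}; countable C; Complete_Partial_Order.chain (\<le>) C\<rbrakk>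
      \<Longrightarrow> \<exists>t. isGlb UNIV C t"
    and A2_left: "\<And>a b :: 'a. a \<le> a + b"
    and A2_right: "\<And>a b :: 'a. b \<le> a + b"
    and A3_add_sup: "\<And>(C :: 'a set) s a. \<lbrakk>C \<noteq> {}; countable C; Complete_Partial_Order.chain (\<le>) C;
      bdd_above C; isLub UNIV C s\<rbrakk> \<Longrightarrow> isLub UNIV ((\<lambda>x. a + x) ` C) (a + s)"
    and A3_mult_sup: "\<And>(C :: 'a set) s a. \<lbrakk>C \<noteq> {}; countable C; Complete_Partial_Order.chain (\<le>) C;
      bdd_above C; isLub UNIV C s\<rbrakk> \<Longrightarrow> isLub UNIV ((\<lambda>x. a * x) ` C) (a * s)"
    and A3_add_inf: "\<And>(C :: 'a set) t c. \<lbrakk>C \<noteq> {}; countable C; Complete_Partial_Order.chain (\<le>) C;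
      isGlb UNIV C t\<rbrakk> \<Longrightarrow> isGlb UNIV ((\<lambda>x. c + x) ` C) (c + t)"
    and A3_mult_inf: "\<And>(C :: 'a set) t c. \<lbrakk>C \<noteq> {}; countable C; Complete_Partial_Order.chain (\<le>) C;
      isGlb UNIV C t\<rbrakk> \<Longrightarrow> isGlb UNIV ((\<lambda>x. c * x) ` C) (c * t)"

text \<open>The recursion of \<^const>\<open>pow_mat\<close>, whose sort \<open>semiring_1\<close> would force \<open>0 \<noteq> 1\<close>.\<close>

primrec mat_power :: "'a :: {semiring_0, monoid_mult} mat \<Rightarrow> nat \<Rightarrow> 'a mat" where
  "mat_power A 0 = 1\<^sub>m (dim_row A)"
| "mat_power A (Suc k) = mat_power A k * A"

text \<open>\<open>kleene_sum A b k\<close> is $b + Ab + \dots + A^{k-1} b$.\<close>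

definition kleene_sum :: "'a :: {semiring_0, monoid_mult} mat \<Rightarrow> 'a vec \<Rightarrow> nat \<Rightarrow> 'a vec" where
  "kleene_sum A b k = finsum_vec TYPE('a) (dim_vec b) (\<lambda>i. mat_power A i *\<^sub>v b) {..<k}"

text \<open>
  \<open>kleene_star_vec A b\<close> is $A^{\ast} b$. It is meaningful only if the supremum exists; it need not be the
  product of a matrix with \<open>b\<close>.
\<close>

definition kleene_star_vec :: "'a :: {semiring_0, monoid_mult, order} mat \<Rightarrow> 'a vec \<Rightarrow> 'a vec" where
  "kleene_star_vec A b =
    (THE s. isLub (carrier_vec (dim_vec b)) {kleene_sum A b k | k. k \<ge> 1} s)"

end

theory Submission
  imports Defs
begin

text \<open>
  Why the theorem is true. Unfolding \<open>x = A x + b\<close> repeatedly gives, for a solution \<open>x\<close>,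
  \<open>x = A\<^sup>k x + S\<^sub>k\<close> with \<open>S\<^sub>k = b + A b + \<dots> + A\<^sup>k\<^sup>-\<^sup>1 b\<close>
  (lemma \<open>solution_unfold\<close>). Since sums dominate their summands, \<open>S\<^sub>k\<close> increases and is bounded by
  \<open>x\<close>, while \<open>A\<^sup>k x\<close> decreases because \<open>A x \<le> x\<close>. Let \<open>s\<close> be the supremum of the former and \<open>w\<close>
  the infimum of the latter. Multiplication by \<open>A\<close> and addition preserve monotone limits, so
  \<open>s = A s + b\<close> and \<open>w = A w\<close>. Finally \<open>x = w + s\<close>, although this is a sum of an infimum and a
  supremum: \<open>w + S\<^sub>k \<le> A\<^sup>k x + S\<^sub>k = x\<close> gives \<open>w + s \<le> x\<close> on passing to the supremum, and
  \<open>x = A\<^sup>k x + S\<^sub>k \<le> A\<^sup>k x + s\<close> gives \<open>x \<le> w + s\<close> on passing to the infimum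
  (lemma \<open>solution_decomposition\<close>). Conversely, adding a fixed vector of \<open>A\<close> to the solution \<open>s\<close>
  gives a solution by distributivity. The hypothesis of the uniqueness claim says that \<open>w = 0\<close>.

  The work lies in passing from the axioms, which speak of a single chain of scalars and a fixed
  summand or left factor, to matrix-vector products, where several chains vary together. The usual
  diagonal argument does this (lemma \<open>limit_add\<close>). It is the same for suprema of increasing and
  infima of decreasing sequences, so it is carried out once, over an abstract order \<open>leq\<close> that is later
  instantiated by both \<open>(\<le>)\<close> and \<open>(\<ge>)\<close>.
\<close>

section \<open>Monotone limits of scalars\<close>

text \<open>
  Monotonicity is part of the notion because the axioms are continuity statements about chains only.
  For \<open>leq = (\<ge>)\<close> the notion is that of the infimum of a decreasing sequence.
\<close>

definition monotone_limit :: "('a \<Rightarrow> 'a \<Rightarrow> bool) \<Rightarrow> (nat \<Rightarrow> 'a) \<Rightarrow> 'a \<Rightarrow> bool" where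
  "monotone_limit leq f s \<longleftrightarrow>
    (\<forall>k. leq (f k) (f (Suc k))) \<and> (\<forall>k. leq (f k) s) \<and> (\<forall>u. (\<forall>k. leq (f k) u) \<longrightarrow> leq s u)"

lemma monotone_limitD:
  assumes "monotone_limit leq f s"
  shows "leq (f k) (f (Suc k))" "leq (f k) s" "(\<And>k. leq (f k) u) \<Longrightarrow> leq s u"
  using assms unfolding monotone_limit_def by blast+

locale monotone_continuous_semiring = ordering leq lneq
  for leq lneq :: "'a :: {semiring_0, monoid_mult} \<Rightarrow> 'a \<Rightarrow> bool" +
  assumes limit_exists: "(\<And>k. leq (f k) (f (Suc k))) \<Longrightarrow> (\<And>k. leq (f k) u) \<Longrightarrow> \<exists>s. monotone_limit leq f s"
    and limit_add_const: "monotone_limit leq f s \<Longrightarrow> monotone_limit leq (\<lambda>k. a + f k) (a + s)"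
    and limit_mult_const: "monotone_limit leq f s \<Longrightarrow> monotone_limit leq (\<lambda>k. a * f k) (a * s)"
begin

lemma limit_unique: "monotone_limit leq f s \<Longrightarrow> monotone_limit leq f t \<Longrightarrow> s = t"
  unfolding monotone_limit_def by (blast intro: antisym)

lemma monotone_limit_const: "monotone_limit leq (\<lambda>k. c) c"
  by (simp add: monotone_limit_def refl)

lemma limit_Suc:
  assumes "monotone_limit leq f s"
  shows "monotone_limit leq (\<lambda>k. f (Suc k)) s"
  using assms unfolding monotone_limit_def by (meson trans)

lemma le_sequence:
  assumes "\<And>k. leq (f k) (f (Suc k))" and "i \<le> j"
  shows "leq (f i) (f j)"
  using \<open>i \<le> j\<close> by (induction rule: dec_induct) (use assms(1) refl trans in blast)+

text \<open>
  Continuity is what makes the operations monotone: if \<open>leq x y\<close>, then \<open>y\<close> is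
  the limit of the sequence \<open>x, y, y, \<dots>\<close>.
\<close>

lemma two_step_limit:
  assumes "leq x y"
  shows "monotone_limit leq (\<lambda>k. if k = 0 then x else y) y"
  unfolding monotone_limit_def using assms refl by (auto dest: spec[of _ "Suc 0"])

lemma add_left_mono_le: "leq x y \<Longrightarrow> leq (a + x) (a + y)"
  using monotone_limitD(2)[OF limit_add_const[OF two_step_limit[of x y]], of a 0] by simp

lemma add_mono_le: "leq x x' \<Longrightarrow> leq y y' \<Longrightarrow> leq (x + y) (x' + y')"
  by (metis add.commute add_left_mono_le trans)

text \<open>
  The diagonal sequence \<open>f k + g k\<close> has the same upper bounds as all the sums \<open>f i + g j\<close>, and the
  limit of these can be taken in one index at a time.
\<close>

lemma limit_add:
  assumes f: "monotone_limit leq f s" and g: "monotone_limit leq g t"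
  shows "monotone_limit leq (\<lambda>k. f k + g k) (s + t)"
  unfolding monotone_limit_def
proof (intro conjI allI impI)
  fix u assume u: "\<forall>k. leq (f k + g k) u"
  have "leq (f i + g j) u" for i j
  proof -
    have "leq (f i) (f (max i j))" "leq (g j) (g (max i j))"
      using le_sequence[of f, OF monotone_limitD(1)[OF f]] le_sequence[of g, OF monotone_limitD(1)[OF g]]
      by simp_all
    then show ?thesis using u add_mono_le trans by blast
  qed
  then have "leq (f i + t) u" for i
    using monotone_limitD(3)[OF limit_add_const[OF g]] by blast
  then have "leq (t + f i) u" for i
    by (simp add: add.commute)
  then have "leq (t + s) u"
    using monotone_limitD(3)[OF limit_add_const[OF f]] by blast
  then show "leq (s + t) u"
    by (simp add: add.commute)
qed (intro add_mono_le monotone_limitD(1,2)[OF f] monotone_limitD(1,2)[OF g])+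

lemma limit_sum:
  assumes "finite J" and "\<And>j. j \<in> J \<Longrightarrow> monotone_limit leq (f j) (s j)"
  shows "monotone_limit leq (\<lambda>k. \<Sum>j\<in>J. f j k) (\<Sum>j\<in>J. s j)"
  using assms by (induction J rule: finite_induct) (auto intro: monotone_limit_const limit_add)

end

section \<open>Monotone limits of vectors\<close>

definition monotone_limit_vec ::
    "('a \<Rightarrow> 'a \<Rightarrow> bool) \<Rightarrow> nat \<Rightarrow> (nat \<Rightarrow> 'a vec) \<Rightarrow> 'a vec \<Rightarrow> bool" where
  "monotone_limit_vec leq n F s \<longleftrightarrow> (\<forall>k. F k \<in> carrier_vec n) \<and> s \<in> carrier_vec n
    \<and> (\<forall>i<n. monotone_limit leq (\<lambda>k. F k $ i) (s $ i))"

context monotone_continuous_semiring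
begin

lemma limit_vec_exists:
  assumes F: "\<And>k. F k \<in> carrier_vec n"
    and incr: "\<And>i k. i < n \<Longrightarrow> leq (F k $ i) (F (Suc k) $ i)"
    and bound: "\<And>i k. i < n \<Longrightarrow> leq (F k $ i) (u $ i)"
  shows "\<exists>s. monotone_limit_vec leq n F s"
proof -
  have "\<exists>t. monotone_limit leq (\<lambda>k. F k $ i) t" if "i < n" for i
    using limit_exists[of "\<lambda>k. F k $ i" "u $ i"] incr bound that by blast
  then obtain t where "\<And>i. i < n \<Longrightarrow> monotone_limit leq (\<lambda>k. F k $ i) (t i)"
    by metis
  then have "monotone_limit_vec leq n F (vec n t)"
    using F by (auto simp: monotone_limit_vec_def)
  then show ?thesis ..
qed

lemma limit_vec_unique:
  assumes "monotone_limit_vec leq n F s" and "monotone_limit_vec leq n F t"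
  shows "s = t"
proof (rule eq_vecI)
  show "dim_vec s = dim_vec t"
    using assms by (auto simp: monotone_limit_vec_def)
  show "s $ i = t $ i" if "i < dim_vec t" for i
    using assms that unfolding monotone_limit_vec_def by (metis carrier_vecD limit_unique)
qed

lemma limit_vec_const: "c \<in> carrier_vec n \<Longrightarrow> monotone_limit_vec leq n (\<lambda>k. c) c"
  by (simp add: monotone_limit_vec_def monotone_limit_const)

lemma limit_vec_Suc:
  "monotone_limit_vec leq n F s \<Longrightarrow> monotone_limit_vec leq n (\<lambda>k. F (Suc k)) s"
  using limit_Suc unfolding monotone_limit_vec_def by fast

lemma limit_vec_add:
  assumes "monotone_limit_vec leq n F s" and "monotone_limit_vec leq n G t"
  shows "monotone_limit_vec leq n (\<lambda>k. F k + G k) (s + t)"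
proof -
  have "(F k + G k) $ i = F k $ i + G k $ i" "(s + t) $ i = s $ i + t $ i" if "i < n" for i k
    using assms that unfolding monotone_limit_vec_def by (metis carrier_vecD index_add_vec(1))+
  then show ?thesis
    using assms limit_add unfolding monotone_limit_vec_def by simp
qed

lemma limit_mult_mat_vec:
  assumes A: "A \<in> carrier_mat n n" and F: "monotone_limit_vec leq n F s"
  shows "monotone_limit_vec leq n (\<lambda>k. A *\<^sub>v F k) (A *\<^sub>v s)"
proof -
  have "monotone_limit leq (\<lambda>k. \<Sum>j\<in>{0..<n}. A $$ (i, j) * F k $ j) (\<Sum>j\<in>{0..<n}. A $$ (i, j) * s $ j)"
    for i
    using F by (intro limit_sum limit_mult_const) (auto simp: monotone_limit_vec_def)
  moreover have "(A *\<^sub>v v) $ i = (\<Sum>j\<in>{0..<n}. A $$ (i, j) * v $ j)"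
    if "v \<in> carrier_vec n" "i < n" for v i
    using A that by (auto simp: scalar_prod_def intro!: sum.cong)
  ultimately show ?thesis
    using A F unfolding monotone_limit_vec_def by simp
qed

lemma mult_mat_vec_mono_le:
  assumes A: "A \<in> carrier_mat n n" and x: "x \<in> carrier_vec n" and y: "y \<in> carrier_vec n"
    and "\<And>i. i < n \<Longrightarrow> leq (x $ i) (y $ i)" and "i < n"
  shows "leq ((A *\<^sub>v x) $ i) ((A *\<^sub>v y) $ i)"
proof -
  let ?F = "\<lambda>k :: nat. if k = 0 then x else y"
  have "(\<lambda>k. ?F k $ j) = (\<lambda>k. if k = 0 then x $ j else y $ j)" for j
    by auto
  then have "monotone_limit_vec leq n ?F y"
    using assms by (auto simp: monotone_limit_vec_def intro: two_step_limit)
  from limit_mult_mat_vec[OF A this] show ?thesis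
    using \<open>i < n\<close> monotone_limitD(2)[of leq "\<lambda>k. (A *\<^sub>v ?F k) $ i" "(A *\<^sub>v y) $ i" 0]
    by (auto simp: monotone_limit_vec_def)
qed

end

section \<open>The two orders of a partially ordered semiring\<close>

lemma isLub_range_iff_monotone_limit:
  fixes f :: "nat \<Rightarrow> 'a :: order"
  assumes "\<And>k. f k \<le> f (Suc k)"
  shows "isLub UNIV (range f) s \<longleftrightarrow> monotone_limit (\<le>) f s"
  using assms by (auto simp: isLub_def isUb_def leastP_def setle_def setge_def monotone_limit_def)

lemma isGlb_range_iff_monotone_limit:
  fixes f :: "nat \<Rightarrow> 'a :: order"
  assumes "\<And>k. f (Suc k) \<le> f k"
  shows "isGlb UNIV (range f) s \<longleftrightarrow> monotone_limit (\<ge>) f s"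
  using assms by (auto simp: isGlb_def isLb_def greatestP_def setle_def setge_def monotone_limit_def)

lemma chain_range_increasing:
  fixes f :: "nat \<Rightarrow> 'a :: order"
  assumes "\<And>k. f k \<le> f (Suc k)"
  shows "Complete_Partial_Order.chain (\<le>) (range f)"
  unfolding Complete_Partial_Order.chain_def
  using lift_Suc_mono_le[of f, OF assms] by (metis (mono_tags) imageE nle_le)

lemma chain_range_decreasing:
  fixes f :: "nat \<Rightarrow> 'a :: order"
  assumes "\<And>k. f (Suc k) \<le> f k"
  shows "Complete_Partial_Order.chain (\<le>) (range f)"
  unfolding Complete_Partial_Order.chain_def
  using lift_Suc_antimono_le[of f, OF assms] by (metis (mono_tags) imageE nle_le)

context partially_ordered_semiring
begin

text \<open>
  A map that preserves suprema of chains preserves, in particular, the supremum \<open>y\<close> of a two-element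
  chain \<open>x \<le> y\<close>. The monotonicity so obtained is what keeps the image of a monotone sequence
  monotone.
\<close>

lemma mono_if_preserves_sup:
  assumes cont: "\<And>(C :: 'a set) s. \<lbrakk>C \<noteq> {}; countable C; Complete_Partial_Order.chain (\<le>) C;
      bdd_above C; isLub UNIV C s\<rbrakk> \<Longrightarrow> isLub UNIV (h ` C) (h s)"
    and "x \<le> y"
  shows "h x \<le> (h y :: 'a)"
proof -
  have "isLub UNIV {x, y} y"
    using \<open>x \<le> y\<close> by (auto simp: isLub_def isUb_def leastP_def setle_def setge_def)
  then have "isLub UNIV (h ` {x, y}) (h y)"
    using \<open>x \<le> y\<close> by (intro cont) (auto simp: Complete_Partial_Order.chain_def)
  then show ?thesis
    by (auto simp: isLub_def isUb_def leastP_def setle_def)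
qed

lemmas semiring_add_left_mono = mono_if_preserves_sup[where h = "(+) a" for a, OF A3_add_sup]
lemmas semiring_mult_left_mono = mono_if_preserves_sup[where h = "(*) a" for a, OF A3_mult_sup]

lemma sup_continuous:
  assumes cont: "\<And>(C :: 'a set) s. \<lbrakk>C \<noteq> {}; countable C; Complete_Partial_Order.chain (\<le>) C;
      bdd_above C; isLub UNIV C s\<rbrakk> \<Longrightarrow> isLub UNIV (h ` C) (h s :: 'a)"
    and f: "monotone_limit (\<le>) f s"
  shows "monotone_limit (\<le>) (\<lambda>k. h (f k)) (h s)"
proof -
  have incr: "f k \<le> f (Suc k)" for k
    using monotone_limitD(1)[OF f] .
  have "isLub UNIV (h ` range f) (h s)"
    using f incr monotone_limitD(2)[OF f]
    by (intro cont chain_range_increasing bdd_aboveI2[of _ f s])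
      (auto simp: isLub_range_iff_monotone_limit)
  then show ?thesis
    using isLub_range_iff_monotone_limit[of "\<lambda>k. h (f k)"] mono_if_preserves_sup[of h, OF cont] incr
    by (simp add: image_image)
qed

lemma inf_continuous:
  assumes cont: "\<And>(C :: 'a set) s. \<lbrakk>C \<noteq> {}; countable C; Complete_Partial_Order.chain (\<le>) C;
      isGlb UNIV C s\<rbrakk> \<Longrightarrow> isGlb UNIV (h ` C) (h s)"
    and mono: "\<And>x y. x \<le> y \<Longrightarrow> h x \<le> (h y :: 'a)"
    and f: "monotone_limit (\<ge>) f s"
  shows "monotone_limit (\<ge>) (\<lambda>k. h (f k)) (h s)"
proof -
  have decr: "f (Suc k) \<le> f k" for k
    using monotone_limitD(1)[OF f] .
  have "isGlb UNIV (h ` range f) (h s)"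
    using f decr by (intro cont chain_range_decreasing) (auto simp: isGlb_range_iff_monotone_limit)
  then show ?thesis
    using isGlb_range_iff_monotone_limit[of "\<lambda>k. h (f k)"] mono decr
    by (simp add: image_image)
qed

sublocale sup: monotone_continuous_semiring "(\<le>)" "(<) :: 'a \<Rightarrow> 'a \<Rightarrow> bool"
proof
  fix f :: "nat \<Rightarrow> 'a" and u
  assume incr: "\<And>k. f k \<le> f (Suc k)" and "\<And>k. f k \<le> u"
  then have "bdd_above (range f)"
    by (intro bdd_aboveI2)
  then show "\<exists>s. monotone_limit (\<le>) f s"
    using A1_sup[of "range f"] chain_range_increasing[of f, OF incr]
    by (simp add: isLub_range_iff_monotone_limit[of f, OF incr])
next
  fix f :: "nat \<Rightarrow> 'a" and s a
  assume f: "monotone_limit (\<le>) f s"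
  show "monotone_limit (\<le>) (\<lambda>k. a + f k) (a + s)"
    by (rule sup_continuous[OF A3_add_sup f])
  show "monotone_limit (\<le>) (\<lambda>k. a * f k) (a * s)"
    by (rule sup_continuous[OF A3_mult_sup f])
qed

sublocale inf: monotone_continuous_semiring "(\<ge>)" "(>) :: 'a \<Rightarrow> 'a \<Rightarrow> bool"
proof
  fix f :: "nat \<Rightarrow> 'a" and u
  assume decr: "\<And>k. f (Suc k) \<le> f k"
  show "\<exists>s. monotone_limit (\<ge>) f s"
    using A1_inf[of "range f"] chain_range_decreasing[of f, OF decr]
    by (simp add: isGlb_range_iff_monotone_limit[of f, OF decr])
next
  fix f :: "nat \<Rightarrow> 'a" and s a
  assume f: "monotone_limit (\<ge>) f s"
  show "monotone_limit (\<ge>) (\<lambda>k. a + f k) (a + s)"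
    by (rule inf_continuous[OF A3_add_inf semiring_add_left_mono f])
  show "monotone_limit (\<ge>) (\<lambda>k. a * f k) (a * s)"
    by (rule inf_continuous[OF A3_mult_inf semiring_mult_left_mono f])
qed

end

lemma monotone_limit_vec_isLub:
  fixes s :: "'a :: order vec"
  assumes s: "monotone_limit_vec (\<le>) n F s"
  shows "isLub (carrier_vec n) (range F) s"
  unfolding isLub_def isUb_def leastP_def setle_def setge_def
proof safe
  show "s \<in> carrier_vec n" "F k \<le> s" for k
    using s by (auto simp: monotone_limit_vec_def monotone_limit_def less_eq_vec_def)
  fix u assume u: "u \<in> carrier_vec n" "\<forall>y\<in>range F. y \<le> u"
  then have "F k $ i \<le> u $ i" if "i < n" for i k
    using that by (auto simp: less_eq_vec_def)
  then have "s $ i \<le> u $ i" if "i < n" for i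
    using s that unfolding monotone_limit_vec_def monotone_limit_def by blast
  then show "s \<le> u"
    using s u(1) by (auto simp: monotone_limit_vec_def less_eq_vec_def)
qed

lemma monotone_limit_vec_isGlb:
  fixes s :: "'a :: order vec"
  assumes s: "monotone_limit_vec (\<ge>) n F s"
  shows "isGlb (carrier_vec n) (range F) s"
  unfolding isGlb_def isLb_def greatestP_def setle_def setge_def
proof safe
  show "s \<in> carrier_vec n"
    using s by (simp add: monotone_limit_vec_def)
  show "s \<le> F k" for k
    using s unfolding monotone_limit_vec_def monotone_limit_def less_eq_vec_def
    by (metis carrier_vecD)
  fix u assume u: "u \<in> carrier_vec n" "\<forall>y\<in>range F. u \<le> y"
  then have "u $ i \<le> F k $ i" if "i < n" for i k
    using that s by (auto simp: monotone_limit_vec_def less_eq_vec_def)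
  then have "u $ i \<le> s $ i" if "i < n" for i
    using s that unfolding monotone_limit_vec_def monotone_limit_def by blast
  then show "u \<le> s"
    using s u(1) by (auto simp: monotone_limit_vec_def less_eq_vec_def)
qed

lemma isLub_order_unique:
  fixes s :: "'a :: order"
  shows "isLub R C s \<Longrightarrow> isLub R C t \<Longrightarrow> s = t"
  by (auto simp: isLub_def leastP_def setge_def intro: antisym)

lemma isGlb_order_unique:
  fixes s :: "'a :: order"
  shows "isGlb R C s \<Longrightarrow> isGlb R C t \<Longrightarrow> s = t"
  by (auto simp: isGlb_def greatestP_def setle_def intro: antisym)

section \<open>Unfolding the equation\<close>

lemma mat_power_carrier: "A \<in> carrier_mat n n \<Longrightarrow> mat_power A k \<in> carrier_mat n n"
  by (induction k) auto

lemma mat_power_0_mult_vec: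
  assumes "A \<in> carrier_mat n n" and "v \<in> carrier_vec n"
  shows "mat_power A 0 *\<^sub>v v = v"
  using assms
  by (intro eq_vecI) (auto simp: scalar_prod_def if_distrib[where f = "\<lambda>x. x * _"] cong: if_cong)

lemma mat_power_Suc_mult_vec:
  assumes A: "A \<in> carrier_mat n n" and v: "v \<in> carrier_vec n"
  shows "mat_power A (Suc k) *\<^sub>v v = A *\<^sub>v (mat_power A k *\<^sub>v v)"
  using v
proof (induction k arbitrary: v)
  case 0
  then show ?case
    using A mat_power_0_mult_vec[OF A] mat_power_carrier[OF A, of 0]
    by (simp add: assoc_mult_mat_vec[of _ n n _ n] del: mat_power.simps(1))
next
  case (Suc k)
  have "mat_power A (Suc (Suc k)) *\<^sub>v v = mat_power A (Suc k) *\<^sub>v (A *\<^sub>v v)"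
    using assoc_mult_mat_vec[OF mat_power_carrier[OF A, of "Suc k"] A Suc.prems]
    by (simp del: mat_power.simps add: mat_power.simps(2)[of A "Suc k"])
  also have "\<dots> = A *\<^sub>v (mat_power A k *\<^sub>v (A *\<^sub>v v))"
    using Suc.IH[of "A *\<^sub>v v"] A Suc.prems by simp
  also have "mat_power A k *\<^sub>v (A *\<^sub>v v) = mat_power A (Suc k) *\<^sub>v v"
    using assoc_mult_mat_vec[OF mat_power_carrier[OF A, of k] A Suc.prems] by simp
  finally show ?case .
qed

lemma mat_power_mult_vec_carrier:
  "A \<in> carrier_mat n n \<Longrightarrow> v \<in> carrier_vec n \<Longrightarrow> mat_power A k *\<^sub>v v \<in> carrier_vec n"
  using mult_mat_vec_carrier mat_power_carrier by blast

lemma kleene_sum_0: "b \<in> carrier_vec n \<Longrightarrow> kleene_sum A b 0 = 0\<^sub>v n"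
  by (auto simp: kleene_sum_def finsum_vec_empty)

lemma kleene_sum_add_power:
  assumes "A \<in> carrier_mat n n" and "b \<in> carrier_vec n"
  shows "kleene_sum A b (Suc k) = mat_power A k *\<^sub>v b + kleene_sum A b k"
  using assms mat_power_mult_vec_carrier[OF assms]
  by (auto simp: kleene_sum_def lessThan_Suc finsum_vec_insert)

lemma kleene_sum_carrier:
  assumes "A \<in> carrier_mat n n" and "b \<in> carrier_vec n"
  shows "kleene_sum A b k \<in> carrier_vec n"
  using assms mat_power_mult_vec_carrier[OF assms]
  by (auto simp: kleene_sum_def intro!: finsum_vec_closed)

lemma mult_mat_zero_vec: "A \<in> carrier_mat n n \<Longrightarrow> A *\<^sub>v 0\<^sub>v n = 0\<^sub>v n"
  by (intro eq_vecI) (auto simp: scalar_prod_def)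

text \<open>The Horner form of the partial sums, which exhibits them as the iterates of \<open>x \<mapsto> A x + b\<close> from \<open>0\<close>.\<close>

lemma kleene_sum_Suc:
  assumes A: "A \<in> carrier_mat n n" and b: "b \<in> carrier_vec n"
  shows "kleene_sum A b (Suc k) = A *\<^sub>v kleene_sum A b k + b"
proof (induction k)
  case 0
  show ?case
    using A b kleene_sum_add_power[OF A b, of 0]
    by (simp add: kleene_sum_0 mat_power_0_mult_vec mult_mat_zero_vec del: mat_power.simps)
next
  case (Suc k)
  note carrier = mat_power_mult_vec_carrier[OF A b, of k] kleene_sum_carrier[OF A b, of k]
  have "kleene_sum A b (Suc (Suc k)) = A *\<^sub>v (mat_power A k *\<^sub>v b) + (A *\<^sub>v kleene_sum A b k + b)"
    using kleene_sum_add_power[OF A b, of "Suc k"] mat_power_Suc_mult_vec[OF A b] Suc by simp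
  also have "\<dots> = A *\<^sub>v (mat_power A k *\<^sub>v b + kleene_sum A b k) + b"
    using A b carrier by (simp add: mult_add_distrib_mat_vec[OF A] assoc_add_vec[of _ n])
  finally show ?case
    by (simp only: kleene_sum_add_power[OF A b])
qed

lemma solution_unfold:
  assumes A: "A \<in> carrier_mat n n" and b: "b \<in> carrier_vec n" and x: "x \<in> carrier_vec n"
    and sol: "x = A *\<^sub>v x + b"
  shows "mat_power A k *\<^sub>v x + kleene_sum A b k = x"
proof (induction k)
  case 0
  show ?case
    using A b x by (simp add: kleene_sum_0 mat_power_0_mult_vec del: mat_power.simps)
next
  case (Suc k)
  note carrier = mat_power_mult_vec_carrier[OF A x, of k] kleene_sum_carrier[OF A b, of k]
  have "mat_power A (Suc k) *\<^sub>v x + kleene_sum A b (Suc k)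
      = A *\<^sub>v (mat_power A k *\<^sub>v x) + (A *\<^sub>v kleene_sum A b k + b)"
    by (simp only: mat_power_Suc_mult_vec[OF A x] kleene_sum_Suc[OF A b])
  also have "\<dots> = A *\<^sub>v (mat_power A k *\<^sub>v x + kleene_sum A b k) + b"
    using A b carrier by (simp add: mult_add_distrib_mat_vec[OF A] assoc_add_vec[of _ n])
  finally show ?case
    using Suc sol by simp
qed

lemma fixed_vector_add_solution:
  assumes A: "A \<in> carrier_mat n n" and b: "b \<in> carrier_vec n"
    and v: "v \<in> carrier_vec n" "A *\<^sub>v v = v" and s: "s \<in> carrier_vec n" "s = A *\<^sub>v s + b"
  shows "v + s = A *\<^sub>v (v + s) + b"
proof -
  have "A *\<^sub>v (v + s) + b = v + (A *\<^sub>v s + b)"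
    using A b v s(1) by (simp add: mult_add_distrib_mat_vec[OF A] assoc_add_vec[of _ n])
  then show ?thesis
    using s(2) by simp
qed

section \<open>The solution set\<close>

context partially_ordered_semiring
begin

lemma kleene_sum_limit_exists:
  fixes A :: "'a mat"
  assumes A: "A \<in> carrier_mat n n" and b: "b \<in> carrier_vec n" and x: "x \<in> carrier_vec n"
    and sol: "x = A *\<^sub>v x + b"
  shows "\<exists>s. monotone_limit_vec (\<le>) n (kleene_sum A b) s"
proof (rule sup.limit_vec_exists)
  fix i k assume i: "i < n"
  have "kleene_sum A b (Suc k) $ i = (mat_power A k *\<^sub>v b) $ i + kleene_sum A b k $ i"
    using i kleene_sum_carrier[OF A b, of k] by (simp add: kleene_sum_add_power[OF A b])
  then show "kleene_sum A b k $ i \<le> kleene_sum A b (Suc k) $ i"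
    using A2_right by simp
  have "x $ i = (mat_power A k *\<^sub>v x) $ i + kleene_sum A b k $ i"
    using i kleene_sum_carrier[OF A b, of k] solution_unfold[OF A b x sol, of k]
    by (metis carrier_vecD index_add_vec(1))
  then show "kleene_sum A b k $ i \<le> x $ i"
    using A2_right by simp
qed (rule kleene_sum_carrier[OF A b])

lemma limit_kleene_sum_solution:
  fixes A :: "'a mat"
  assumes A: "A \<in> carrier_mat n n" and b: "b \<in> carrier_vec n"
    and s: "monotone_limit_vec (\<le>) n (kleene_sum A b) s"
  shows "s = A *\<^sub>v s + b"
proof (rule sup.limit_vec_unique)
  show "monotone_limit_vec (\<le>) n (\<lambda>k. kleene_sum A b (Suc k)) s"
    by (rule sup.limit_vec_Suc[OF s])
  show "monotone_limit_vec (\<le>) n (\<lambda>k. kleene_sum A b (Suc k)) (A *\<^sub>v s + b)"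
    unfolding kleene_sum_Suc[OF A b]
    by (intro sup.limit_vec_add sup.limit_mult_mat_vec A s sup.limit_vec_const b)
qed

text \<open>
  The iterates of a vector with \<open>A x \<le> x\<close> decrease, and \<open>0\<close> bounds them from below because
  \<open>0 \<le> 0 + a\<close>.
\<close>

lemma subinvariant_limit_exists:
  fixes A :: "'a mat"
  assumes A: "A \<in> carrier_mat n n" and x: "x \<in> carrier_vec n" and sub: "A *\<^sub>v x \<le> x"
  shows "\<exists>w. monotone_limit_vec (\<ge>) n (\<lambda>k. mat_power A k *\<^sub>v x) w"
proof (rule inf.limit_vec_exists)
  fix i k assume i: "i < n"
  then show "(mat_power A (Suc k) *\<^sub>v x) $ i \<le> (mat_power A k *\<^sub>v x) $ i"
  proof (induction k arbitrary: i)
    case 0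
    then show ?case
      using sub x mat_power_Suc_mult_vec[OF A x, of 0] mat_power_0_mult_vec[OF A x]
      by (simp add: less_eq_vec_def del: mat_power.simps index_mult_mat_vec)
  next
    case (Suc k)
    show ?case
      unfolding mat_power_Suc_mult_vec[OF A x, of "Suc k"] mat_power_Suc_mult_vec[OF A x, of k]
      using sup.mult_mat_vec_mono_le[OF A _ mat_power_mult_vec_carrier[OF A x] _ Suc.prems]
        Suc.IH mat_power_mult_vec_carrier[OF A x] mat_power_Suc_mult_vec[OF A x, of k]
      by metis
  qed
  show "0\<^sub>v n $ i \<le> (mat_power A k *\<^sub>v x) $ i"
    using A2_left[of 0] i by simp
qed (rule mat_power_mult_vec_carrier[OF A x])

lemma limit_power_fixed:
  fixes A :: "'a mat"
  assumes A: "A \<in> carrier_mat n n" and x: "x \<in> carrier_vec n"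
    and w: "monotone_limit_vec (\<ge>) n (\<lambda>k. mat_power A k *\<^sub>v x) w"
  shows "A *\<^sub>v w = w"
proof (rule inf.limit_vec_unique)
  show "monotone_limit_vec (\<ge>) n (\<lambda>k. mat_power A (Suc k) *\<^sub>v x) (A *\<^sub>v w)"
    unfolding mat_power_Suc_mult_vec[OF A x] by (rule inf.limit_mult_mat_vec[OF A w])
  show "monotone_limit_vec (\<ge>) n (\<lambda>k. mat_power A (Suc k) *\<^sub>v x) w"
    by (rule inf.limit_vec_Suc[OF w])
qed

lemma solution_subinvariant:
  fixes A :: "'a mat"
  assumes A: "A \<in> carrier_mat n n" and b: "b \<in> carrier_vec n" and x: "x \<in> carrier_vec n"
    and sol: "x = A *\<^sub>v x + b"
  shows "A *\<^sub>v x \<le> x"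
  unfolding less_eq_vec_def
proof (intro conjI allI impI)
  fix i assume "i < dim_vec x"
  then have "x $ i = (A *\<^sub>v x) $ i + b $ i"
    using b x arg_cong[OF sol, of "\<lambda>v. v $ i"] by simp
  then show "(A *\<^sub>v x) $ i \<le> x $ i"
    using A2_left by simp
qed (use A x in simp)

text \<open>
  Each inequality replaces one of the two varying summands in \<open>A\<^sup>k x + S\<^sub>k = x\<close> by its limit, which
  leaves a single monotone sequence whose limit can then be taken.
\<close>

lemma solution_decomposition:
  fixes A :: "'a mat"
  assumes A: "A \<in> carrier_mat n n" and b: "b \<in> carrier_vec n" and x: "x \<in> carrier_vec n"
    and sol: "x = A *\<^sub>v x + b"
    and s: "monotone_limit_vec (\<le>) n (kleene_sum A b) s"
    and w: "monotone_limit_vec (\<ge>) n (\<lambda>k. mat_power A k *\<^sub>v x) w"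
  shows "x = w + s"
proof (rule eq_vecI)
  have s_carrier: "s \<in> carrier_vec n"
    using s by (simp add: monotone_limit_vec_def)
  then show "dim_vec x = dim_vec (w + s)"
    using x by simp
  fix i assume "i < dim_vec (w + s)"
  then have i: "i < n"
    using s_carrier by simp
  let ?P = "\<lambda>k. (mat_power A k *\<^sub>v x) $ i" and ?S = "\<lambda>k. kleene_sum A b k $ i"
  have lim_S: "monotone_limit (\<le>) ?S (s $ i)" and lim_P: "monotone_limit (\<ge>) ?P (w $ i)"
    using s w i by (auto simp: monotone_limit_vec_def)
  have unfold: "?P k + ?S k = x $ i" for k
    using i kleene_sum_carrier[OF A b, of k] solution_unfold[OF A b x sol, of k]
    by (metis carrier_vecD index_add_vec(1))
  have "w $ i + ?S k \<le> x $ i" for k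
    using sup.add_mono_le[OF monotone_limitD(2)[OF lim_P] order_refl, of "?S k" k] unfold by simp
  then have "w $ i + s $ i \<le> x $ i"
    by (rule monotone_limitD(3)[OF sup.limit_add_const[OF lim_S]])
  moreover have "x $ i \<le> s $ i + ?P k" for k
    using sup.add_left_mono_le[OF monotone_limitD(2)[OF lim_S], of "?P k" k] unfold
    by (simp add: add.commute)
  then have "x $ i \<le> s $ i + w $ i"
    by (rule monotone_limitD(3)[OF inf.limit_add_const[OF lim_P]])
  ultimately show "x $ i = (w + s) $ i"
    using i s_carrier by (simp add: add.commute antisym)
qed

end

theorem theorem3p2:
  fixes A :: "'a :: {semiring_0, monoid_mult, order} mat" and b :: "'a vec" and n :: nat
  assumes "partially_ordered_semiring TYPE('a)"
    and "A \<in> carrier_mat n n"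
    and "b \<in> carrier_vec n"
    and "\<exists>x \<in> carrier_vec n. x = A *\<^sub>v x + b"
  shows "isLub (carrier_vec n) {kleene_sum A b k | k. k \<ge> 1} (kleene_star_vec A b)
    \<and> {x \<in> carrier_vec n. x = A *\<^sub>v x + b}
        = {v + kleene_star_vec A b | v. v \<in> carrier_vec n \<and> A *\<^sub>v v = v}
    \<and> ((\<forall>x \<in> carrier_vec n. A *\<^sub>v x \<le> x \<longrightarrow>
            isGlb (carrier_vec n) (range (\<lambda>k. mat_power A k *\<^sub>v x)) (0\<^sub>v n))
        \<longrightarrow> (\<forall>x \<in> carrier_vec n. x = A *\<^sub>v x + b \<longleftrightarrow> x = kleene_star_vec A b))"
proof -
  interpret partially_ordered_semiring "TYPE('a)"
    by fact
  note A = assms(2) and b = assms(3)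
  let ?s = "kleene_star_vec A b"
  obtain s where s: "monotone_limit_vec (\<le>) n (kleene_sum A b) s"
    using assms(4) kleene_sum_limit_exists[OF A b] by blast
  have "{kleene_sum A b k | k. k \<ge> 1} = range (\<lambda>k. kleene_sum A b (Suc k))"
    by (auto simp: image_iff) (metis Suc_le_D)
  then have lub: "isLub (carrier_vec n) {kleene_sum A b k | k. k \<ge> 1} s"
    using monotone_limit_vec_isLub[OF sup.limit_vec_Suc[OF s]] by simp
  then have star: "?s = s"
    using b isLub_order_unique unfolding kleene_star_vec_def by (intro the_equality) auto
  have s_carrier: "s \<in> carrier_vec n"
    using s by (simp add: monotone_limit_vec_def)
  have s_sol: "s = A *\<^sub>v s + b"
    by (rule limit_kleene_sum_solution[OF A b s])

  have decomp: "\<exists>w. monotone_limit_vec (\<ge>) n (\<lambda>k. mat_power A k *\<^sub>v x) w \<and> x = w + s"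
    if "x \<in> carrier_vec n" "x = A *\<^sub>v x + b" for x
    using subinvariant_limit_exists[OF A that(1) solution_subinvariant[OF A b that]]
      solution_decomposition[OF A b that s] by blast

  have "{x \<in> carrier_vec n. x = A *\<^sub>v x + b} = {v + s | v. v \<in> carrier_vec n \<and> A *\<^sub>v v = v}"
  proof (intro equalityI subsetI)
    fix x assume "x \<in> {x \<in> carrier_vec n. x = A *\<^sub>v x + b}"
    then have x: "x \<in> carrier_vec n" "x = A *\<^sub>v x + b"
      by auto
    then obtain w where "monotone_limit_vec (\<ge>) n (\<lambda>k. mat_power A k *\<^sub>v x) w" "x = w + s"
      using decomp by blast
    then show "x \<in> {v + s | v. v \<in> carrier_vec n \<and> A *\<^sub>v v = v}"
      using limit_power_fixed[OF A x(1)] by (auto simp: monotone_limit_vec_def)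
  next
    fix x assume "x \<in> {v + s | v. v \<in> carrier_vec n \<and> A *\<^sub>v v = v}"
    then show "x \<in> {x \<in> carrier_vec n. x = A *\<^sub>v x + b}"
      using fixed_vector_add_solution[OF A b _ _ s_carrier s_sol] s_carrier by auto
  qed

  moreover have "x = A *\<^sub>v x + b \<longleftrightarrow> x = s"
    if vanish: "\<forall>x \<in> carrier_vec n. A *\<^sub>v x \<le> x \<longrightarrow>
        isGlb (carrier_vec n) (range (\<lambda>k. mat_power A k *\<^sub>v x)) (0\<^sub>v n)"
      and x: "x \<in> carrier_vec n" for x
  proof
    assume sol: "x = A *\<^sub>v x + b"
    then obtain w where w: "monotone_limit_vec (\<ge>) n (\<lambda>k. mat_power A k *\<^sub>v x) w" "x = w + s"
      using decomp x by blast
    have "w = 0\<^sub>v n"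
      using monotone_limit_vec_isGlb[OF w(1)] vanish x solution_subinvariant[OF A b x sol]
        isGlb_order_unique by blast
    then show "x = s"
      using w(2) s_carrier by simp
  next
    assume "x = s"
    then show "x = A *\<^sub>v x + b"
      using s_sol by simp
  qed

  ultimately show ?thesis
    using lub unfolding star by blast
qed

end
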